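(* Let $G$ be a connected graph. Then the following statements are equivalent: (C1) $G$ is $\{P_4, C_4\}$-free; (C2) every MNS ordering of $G$ is a LexDFS ordering of $G$; (C3) every MNS ordering of $G$ is a LexBFS ordering of $G$.
   Context: All graphs are finite and simple. For an ordering $\sigma$ of $V(G)$ write $x<_\sigma y$ if $x$ precedes $y$. In each of the following, the condition is required for all $a<_\sigma b<_\sigma c$ with $ac\in E(G)$ and $ab\notin E(G)$: $\sigma$ is a LexBFS ordering if there is $d$ with $d<_\sigma a$, $db\in E(G)$, $dc\notin E(G)$; a LexDFS ordering if there is $d$ with $a<_\sigma d<_\sigma b$, $db\in E(G)$, $dc\notin E(G)$; an MNS ordering if there is $d$ with $d<_\sigma b$, $db\in E(G)$, $dc\notin E(G)$. $\{P_4,C_4\}$-free means containing no induced path on 4 vertices and no induced 4-cycle. *)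

theory Defs
  imports "Graph_Theory.Graph_Theory"
begin

text \<open>Finite simple graphs are modelled by the locale \<open>pair_graph\<close>: finitely many vertices and a
  symmetric, loop-free set of ordered pairs as arcs. The edge \<open>xy\<close> of the simple graph corresponds to
  the two arcs \<open>(x, y)\<close> and \<open>(y, x)\<close>.\<close>

definition path_graph :: "nat \<Rightarrow> nat pair_pre_digraph" where
  "path_graph n =
     \<lparr> pverts = {..<n}, parcs = {(i, j). i < n \<and> j < n \<and> (j = Suc i \<or> i = Suc j)} \<rparr>"

text \<open>A simple cycle only for \<open>n \<ge> 3\<close>.\<close>

definition cycle_graph :: "nat \<Rightarrow> nat pair_pre_digraph" where
  "cycle_graph n =
     \<lparr> pverts = {..<n},
       parcs = {(i, j). i < n \<and> j < n \<and> (j = Suc i mod n \<or> i = Suc j mod n)} \<rparr>"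

definition contains_induced :: "'a pair_pre_digraph \<Rightarrow> 'b pair_pre_digraph \<Rightarrow> bool" where
  "contains_induced G H \<longleftrightarrow>
     (\<exists>K. induced_subgraph K (with_proj G) \<and> digraph_iso (with_proj H) K)"

definition P4_C4_free :: "'a pair_pre_digraph \<Rightarrow> bool" where
  "P4_C4_free G \<longleftrightarrow>
     \<not> contains_induced G (path_graph 4) \<and> \<not> contains_induced G (cycle_graph 4)"

definition vertex_ordering :: "'a pair_pre_digraph \<Rightarrow> 'a list \<Rightarrow> bool" where
  "vertex_ordering G \<sigma> \<longleftrightarrow> distinct \<sigma> \<and> set \<sigma> = pverts G"

definition precedes :: "'a list \<Rightarrow> 'a \<Rightarrow> 'a \<Rightarrow> bool" where
  "precedes \<sigma> x y \<longleftrightarrow> (\<exists>i j. i < j \<and> j < length \<sigma> \<and> \<sigma> ! i = x \<and> \<sigma> ! j = y)"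

definition LexBFS_ordering :: "'a pair_pre_digraph \<Rightarrow> 'a list \<Rightarrow> bool" where
  "LexBFS_ordering G \<sigma> \<longleftrightarrow> vertex_ordering G \<sigma> \<and>
     (\<forall>a b c. precedes \<sigma> a b \<and> precedes \<sigma> b c \<and> (a, c) \<in> parcs G \<and> (a, b) \<notin> parcs G \<longrightarrow>
        (\<exists>d. precedes \<sigma> d a \<and> (d, b) \<in> parcs G \<and> (d, c) \<notin> parcs G))"

definition LexDFS_ordering :: "'a pair_pre_digraph \<Rightarrow> 'a list \<Rightarrow> bool" where
  "LexDFS_ordering G \<sigma> \<longleftrightarrow> vertex_ordering G \<sigma> \<and>
     (\<forall>a b c. precedes \<sigma> a b \<and> precedes \<sigma> b c \<and> (a, c) \<in> parcs G \<and> (a, b) \<notin> parcs G \<longrightarrow>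
        (\<exists>d. precedes \<sigma> a d \<and> precedes \<sigma> d b \<and> (d, b) \<in> parcs G \<and> (d, c) \<notin> parcs G))"

definition MNS_ordering :: "'a pair_pre_digraph \<Rightarrow> 'a list \<Rightarrow> bool" where
  "MNS_ordering G \<sigma> \<longleftrightarrow> vertex_ordering G \<sigma> \<and>
     (\<forall>a b c. precedes \<sigma> a b \<and> precedes \<sigma> b c \<and> (a, c) \<in> parcs G \<and> (a, b) \<notin> parcs G \<longrightarrow>
        (\<exists>d. precedes \<sigma> d b \<and> (d, b) \<in> parcs G \<and> (d, c) \<notin> parcs G))"

end

theory Submission
  imports Defs
begin

text \<open>Call \<open>a < b < c\<close> with \<open>ac\<close> an edge and \<open>ab\<close> a non-edge an umbrella. All three conditions turn out
  to be equivalent to the absence of umbrellas in MNS orderings.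

  In a \<open>{P\<^sub>4, C\<^sub>4}\<close>-free graph, the vertex \<open>d\<close> that the MNS condition provides for an umbrella
  induces \<open>2K\<^sub>2\<close> together with it, and this yields an umbrella whose middle vertex is earlier.
  Conversely, if \<open>x y z w\<close> induces \<open>P\<^sub>4\<close> or \<open>C\<^sub>4\<close>, an MNS ordering starting with \<open>y, z\<close> has the
  umbrella \<open>z < x < w\<close> or \<open>y < w < x\<close>.

  An umbrella also gives a prefix \<open>P\<close> of an MNS ordering after which two vertices \<open>b, c\<close> with distinct
  maximal labels (sets of neighbours in \<open>P\<close>) are eligible. Both choices extend to MNS orderings. If both
  were LexDFS, the last vertex of \<open>P\<close> in the symmetric difference of the labels could not be
  compensated by a later one; for LexBFS take the first vertex instead.\<close>

subsection \<open>Induced paths and cycles on four vertices\<close>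

text \<open>The witness is the image of \<open>H\<close> under the isomorphism acting as
  \<open>f\<close> on vertices and as \<open>map_prod f f\<close> on arcs. The equivalence for arcs,
  read in both directions, makes this image an induced subgraph.\<close>

lemma contains_inducedI:
  assumes G: "pair_wf_digraph G" and H: "pair_wf_digraph H"
    and inj: "inj_on f (pverts H)" and sub: "f ` pverts H \<subseteq> pverts G"
    and arcs: "\<And>u v. u \<in> pverts H \<Longrightarrow> v \<in> pverts H \<Longrightarrow> (f u, f v) \<in> parcs G \<longleftrightarrow> (u, v) \<in> parcs H"
  shows "contains_induced G H"
proof -
  interpret G: pair_wf_digraph G by fact
  interpret H: pair_wf_digraph H by fact
  define h where "h = \<lparr>iso_verts = f, iso_arcs = map_prod f f, iso_head = snd, iso_tail = fst\<rparr>"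
  have "inj_on (map_prod f f) (parcs H)"
    by (rule inj_on_subset[OF map_prod_inj_on[OF inj inj]]) (auto dest: H.in_arcsD1 H.in_arcsD2)
  then have iso: "pre_digraph.digraph_isomorphism (with_proj H) h"
    using inj H.wf_digraph_axioms
    unfolding pre_digraph.digraph_isomorphism_def h_def by auto
  have arcs_eq: "map_prod f f ` parcs H =
      {e \<in> parcs G. fst e \<in> f ` pverts H \<and> snd e \<in> f ` pverts H}"
  proof (intro equalityI subsetI)
    fix e assume "e \<in> map_prod f f ` parcs H"
    then show "e \<in> {e \<in> parcs G. fst e \<in> f ` pverts H \<and> snd e \<in> f ` pverts H}"
      using arcs by (auto dest: H.in_arcsD1 H.in_arcsD2)
  next
    fix e assume "e \<in> {e \<in> parcs G. fst e \<in> f ` pverts H \<and> snd e \<in> f ` pverts H}"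
    then obtain u v where "u \<in> pverts H" "v \<in> pverts H" "e = (f u, f v)" "e \<in> parcs G"
      by (cases e) auto
    then show "e \<in> map_prod f f ` parcs H"
      using arcs by (intro image_eqI[of _ _ "(u, v)"]) auto
  qed
  have "wf_digraph (app_iso h (with_proj H))"
    by unfold_locales (auto simp: h_def dest: H.in_arcsD1 H.in_arcsD2)
  then have "induced_subgraph (app_iso h (with_proj H)) (with_proj G)"
    using sub arcs_eq G.wf_digraph_axioms
    unfolding induced_subgraph_def subgraph_def compatible_def
    by (auto simp: h_def)
  with iso show ?thesis
    unfolding contains_induced_def digraph_iso_def by blast
qed

text \<open>A subgraph of \<open>with_proj G\<close> inherits the projections \<open>fst\<close> and
  \<open>snd\<close>, so the isomorphism has to send an arc to the pair of images of its ends. Its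
  vertex part therefore serves as \<open>f\<close>.\<close>

lemma contains_inducedE:
  assumes "contains_induced G H"
  obtains f where "inj_on f (pverts H)" "f ` pverts H \<subseteq> pverts G"
    "\<And>u v. u \<in> pverts H \<Longrightarrow> v \<in> pverts H \<Longrightarrow> (f u, f v) \<in> parcs G \<longleftrightarrow> (u, v) \<in> parcs H"
proof -
  from assms obtain h where
    ind: "induced_subgraph (app_iso h (with_proj H)) (with_proj G)" and
    iso: "pre_digraph.digraph_isomorphism (with_proj H) h"
    unfolding contains_induced_def digraph_iso_def by blast
  let ?f = "iso_verts h"
  from iso have inj: "inj_on ?f (pverts H)"
    and wf: "wf_digraph (with_proj H)"
    and ends: "\<And>u v. (u, v) \<in> parcs H \<Longrightarrow>
      ?f u = iso_tail h (iso_arcs h (u, v)) \<and> ?f v = iso_head h (iso_arcs h (u, v))"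
    unfolding pre_digraph.digraph_isomorphism_def by auto
  from ind have sub: "?f ` pverts H \<subseteq> pverts G"
    and proj: "iso_tail h = fst" "iso_head h = snd"
    and arcs: "iso_arcs h ` parcs H =
      {e \<in> parcs G. fst e \<in> ?f ` pverts H \<and> snd e \<in> ?f ` pverts H}"
    unfolding induced_subgraph_def subgraph_def compatible_def by auto
  have img: "iso_arcs h (u, v) = (?f u, ?f v)" if "(u, v) \<in> parcs H" for u v
    using ends[OF that] proj by (simp add: prod_eq_iff)
  have "(?f u, ?f v) \<in> parcs G \<longleftrightarrow> (u, v) \<in> parcs H" if uv: "u \<in> pverts H" "v \<in> pverts H" for u v
  proof
    assume "(u, v) \<in> parcs H"
    then have "(?f u, ?f v) \<in> iso_arcs h ` parcs H" using img by force
    then show "(?f u, ?f v) \<in> parcs G" using arcs by auto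
  next
    assume "(?f u, ?f v) \<in> parcs G"
    then have "(?f u, ?f v) \<in> iso_arcs h ` parcs H" using arcs uv by auto
    \<comment> \<open>The preimage arc is not known to join \<open>u\<close> and \<open>v\<close>;
      injectivity on vertices identifies its ends with them.\<close>
    then obtain u' v' where *: "(u', v') \<in> parcs H" "(?f u, ?f v) = (?f u', ?f v')"
      using img by force
    then have "u' \<in> pverts H" "v' \<in> pverts H"
      using wf_digraph.tail_in_verts[OF wf] wf_digraph.head_in_verts[OF wf] by fastforce+
    with * uv inj show "(u, v) \<in> parcs H" by (auto dest: inj_onD)
  qed
  with inj sub that show thesis by blast
qed

text \<open>The pair \<open>x\<close>, \<open>w\<close> is left open: an edge there gives an induced
  4-cycle, a non-edge an induced path. In a symmetric loop-free graph the remaining inequalities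
  follow from the listed edges and non-edges.\<close>

definition P4_or_C4 :: "'a pair_pre_digraph \<Rightarrow> 'a \<Rightarrow> 'a \<Rightarrow> 'a \<Rightarrow> 'a \<Rightarrow> bool" where
  "P4_or_C4 G x y z w \<longleftrightarrow> x \<noteq> z \<and> y \<noteq> w \<and>
     (x, y) \<in> parcs G \<and> (y, z) \<in> parcs G \<and> (z, w) \<in> parcs G \<and> (x, z) \<notin> parcs G \<and> (y, w) \<notin> parcs G"

lemma parcs_path_graph_4:
  "parcs (path_graph 4) = {(0, 1), (1, 0), (1, 2), (2, 1), (2, 3), (3, 2)}"
proof -
  have "(i, j) \<in> parcs (path_graph 4) \<longleftrightarrow>
      (i, j) \<in> {(0, 1), (1, 0), (1, 2), (2, 1), (2, 3), (3, 2)}" for i j :: nat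
  proof (cases "i < 4 \<and> j < 4")
    case True
    then have "i \<in> {0, 1, 2, 3}" "j \<in> {0, 1, 2, 3}" by auto
    then show ?thesis by (elim insertE emptyE; simp add: path_graph_def)
  next
    case False
    then show ?thesis by (auto simp: path_graph_def)
  qed
  then show ?thesis by (auto simp: set_eq_iff)
qed

lemma parcs_cycle_graph_4:
  "parcs (cycle_graph 4) = {(0, 1), (1, 0), (1, 2), (2, 1), (2, 3), (3, 2), (3, 0), (0, 3)}"
proof -
  have "(i, j) \<in> parcs (cycle_graph 4) \<longleftrightarrow>
      (i, j) \<in> {(0, 1), (1, 0), (1, 2), (2, 1), (2, 3), (3, 2), (3, 0), (0, 3)}" for i j :: nat
  proof (cases "i < 4 \<and> j < 4")
    case True
    then have "i \<in> {0, 1, 2, 3}" "j \<in> {0, 1, 2, 3}" by auto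
    then show ?thesis by (elim insertE emptyE; simp add: cycle_graph_def)
  next
    case False
    then show ?thesis by (auto simp: cycle_graph_def)
  qed
  then show ?thesis by (auto simp: set_eq_iff)
qed

lemma pverts_path_cycle_graph_4:
  "pverts (path_graph 4) = {0, 1, 2, 3}" "pverts (cycle_graph 4) = {0, 1, 2, 3}"
  by (auto simp: path_graph_def cycle_graph_def)

lemma lessThan_4: "{..<4::nat} = {0, 1, 2, 3}"
  by auto

context pair_graph
begin

lemma edge_commute: "(u, v) \<in> parcs G \<longleftrightarrow> (v, u) \<in> parcs G"
  using pair_sym_arcs by (auto simp: symmetric_def sym_def)

lemma no_loop: "(u, u) \<notin> parcs G"
  using pair_no_loops by fastforce

text \<open>Adjacency of \<open>x\<close> and \<open>w\<close> decides which of the two graphs the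
  pattern embeds. Conversely, 0, 1, 2, 3 in this order form the pattern in both graphs.\<close>

lemma P4_C4_free_iff: "P4_C4_free G \<longleftrightarrow> (\<forall>x y z w. \<not> P4_or_C4 G x y z w)"
proof
  assume free: "P4_C4_free G"
  show "\<forall>x y z w. \<not> P4_or_C4 G x y z w"
  proof (intro allI notI)
    fix x y z w assume *: "P4_or_C4 G x y z w"
    define f where "f i = [x, y, z, w] ! i" for i :: nat
    note edges = *[unfolded P4_or_C4_def]
    have dist: "distinct [x, y, z, w]"
      using edges no_loop edge_commute by (simp add: distinct_length_2_or_more) metis
    have edges': "(y, x) \<in> parcs G" "(z, y) \<in> parcs G" "(w, z) \<in> parcs G"
      "(z, x) \<notin> parcs G" "(w, y) \<notin> parcs G" "(w, x) \<in> parcs G \<longleftrightarrow> (x, w) \<in> parcs G"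
      using edges edge_commute by blast+
    have inV: "{x, y, z, w} \<subseteq> pverts G"
      using edges in_arcsD1 in_arcsD2 by auto
    have inj: "inj_on f {..<4}" and sub: "f ` {..<4} \<subseteq> pverts G"
      using dist inV by (auto simp: f_def lessThan_4)
    show False
    proof (cases "(x, w) \<in> parcs G")
      case True
      have "contains_induced G (cycle_graph 4)"
      proof (rule contains_inducedI)
        show "pair_wf_digraph (cycle_graph 4)"
          by unfold_locales (auto simp: cycle_graph_def)
        show "(f u, f v) \<in> parcs G \<longleftrightarrow> (u, v) \<in> parcs (cycle_graph 4)"
          if "u \<in> pverts (cycle_graph 4)" "v \<in> pverts (cycle_graph 4)" for u v
          using that edges edges' True
          unfolding pverts_path_cycle_graph_4 parcs_cycle_graph_4
          by (elim insertE emptyE; simp add: f_def no_loop)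
      qed (use inj sub pair_wf_digraph_axioms in \<open>simp_all add: cycle_graph_def\<close>)
      with free show False by (simp add: P4_C4_free_def)
    next
      case False
      have "contains_induced G (path_graph 4)"
      proof (rule contains_inducedI)
        show "pair_wf_digraph (path_graph 4)"
          by unfold_locales (auto simp: path_graph_def)
        show "(f u, f v) \<in> parcs G \<longleftrightarrow> (u, v) \<in> parcs (path_graph 4)"
          if "u \<in> pverts (path_graph 4)" "v \<in> pverts (path_graph 4)" for u v
          using that edges edges' False
          unfolding pverts_path_cycle_graph_4 parcs_path_graph_4
          by (elim insertE emptyE; simp add: f_def no_loop)
      qed (use inj sub pair_wf_digraph_axioms in \<open>simp_all add: path_graph_def\<close>)
      with free show False by (simp add: P4_C4_free_def)
    qed
  qed
next
  assume none: "\<forall>x y z w. \<not> P4_or_C4 G x y z w"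
  have "\<not> contains_induced G H" if H: "H = path_graph 4 \<or> H = cycle_graph 4" for H
  proof
    assume "contains_induced G H"
    then obtain f where inj: "inj_on f (pverts H)"
      and arcs: "\<And>u v. u \<in> pverts H \<Longrightarrow> v \<in> pverts H \<Longrightarrow>
        (f u, f v) \<in> parcs G \<longleftrightarrow> (u, v) \<in> parcs H"
      by (rule contains_inducedE) blast
    have V: "pverts H = {0, 1, 2, 3}"
      using H pverts_path_cycle_graph_4 by blast
    have E: "(0, 1) \<in> parcs H" "(1, 2) \<in> parcs H" "(2, 3) \<in> parcs H" "(0, 2) \<notin> parcs H"
      "(1, 3) \<notin> parcs H"
      using H by (elim disjE; simp add: parcs_path_graph_4 parcs_cycle_graph_4)+
    have "P4_or_C4 G (f 0) (f 1) (f 2) (f 3)"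
      unfolding P4_or_C4_def
      using inj_onD[OF inj, of 0 2] inj_onD[OF inj, of 1 3]
        arcs[of 0 1] arcs[of 1 2] arcs[of 2 3] arcs[of 0 2] arcs[of 1 3] E
      by (auto simp: V)
    with none show False by blast
  qed
  then show "P4_C4_free G" by (simp add: P4_C4_free_def)
qed

end

subsection \<open>Prefixes of MNS orderings\<close>

text \<open>Trades comparison of positions for membership in the two sides of a split list;
  distinctness pins \<open>b\<close> to the position \<open>length xs\<close>.\<close>

lemma precedes_append_iff:
  assumes "distinct (xs @ b # ys)"
  shows "precedes (xs @ b # ys) a b \<longleftrightarrow> a \<in> set xs"
    and "precedes (xs @ b # ys) b c \<longleftrightarrow> c \<in> set ys"
proof -
  let ?s = "xs @ b # ys"
  have b: "?s ! length xs = b" by simp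
  have uniq: "i = length xs" if "i < length ?s" "?s ! i = b" for i
    using assms that nth_eq_iff_index_eq[OF assms, of i "length xs"] by simp
  show "precedes ?s a b \<longleftrightarrow> a \<in> set xs"
  proof
    assume "precedes ?s a b"
    then obtain i where "i < length xs" "?s ! i = a"
      using uniq unfolding precedes_def by blast
    then show "a \<in> set xs" by (auto simp: nth_append)
  next
    assume "a \<in> set xs"
    then obtain i where "i < length xs" "xs ! i = a" by (auto simp: in_set_conv_nth)
    then show "precedes ?s a b"
      unfolding precedes_def using b by (intro exI[of _ i] exI[of _ "length xs"]) (simp add: nth_append)
  qed
  show "precedes ?s b c \<longleftrightarrow> c \<in> set ys"
  proof
    assume "precedes ?s b c"
    then obtain i j where ij: "i < j" "j < length ?s" "?s ! i = b" "?s ! j = c"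
      unfolding precedes_def by blast
    then have "i = length xs" using uniq[of i] by simp
    \<comment> \<open>The entry \<open>b\<close> occupies position \<open>length xs\<close>, so
      entry \<open>k\<close> of \<open>ys\<close> has index
      \<open>length xs + Suc k\<close>.\<close>
    then obtain k where "j = length xs + Suc k" using ij(1) less_imp_Suc_add by auto
    then show "c \<in> set ys" using ij by (auto simp: nth_append)
  next
    assume "c \<in> set ys"
    then obtain k where "k < length ys" "ys ! k = c" by (auto simp: in_set_conv_nth)
    then show "precedes ?s b c"
      unfolding precedes_def using b
      by (intro exI[of _ "length xs"] exI[of _ "length xs + Suc k"]) (simp add: nth_append)
  qed
qed

lemma precedes_in_set: "precedes \<sigma> a b \<Longrightarrow> a \<in> set \<sigma> \<and> b \<in> set \<sigma>"
  by (auto simp: precedes_def)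

lemma precedes_nth_iff:
  assumes "distinct \<sigma>" "i < length \<sigma>" "j < length \<sigma>"
  shows "precedes \<sigma> (\<sigma> ! i) (\<sigma> ! j) \<longleftrightarrow> i < j"
  using assms by (auto simp: precedes_def nth_eq_iff_index_eq)

definition label :: "'a pair_pre_digraph \<Rightarrow> 'a set \<Rightarrow> 'a \<Rightarrow> 'a set" where
  "label G S v = {u \<in> S. (u, v) \<in> parcs G}"

text \<open>The search procedure behind MNS orderings: a vertex may be chosen when its label is
  inclusion-maximal among the unvisited ones. Competitors \<open>c\<close> range over all unvisited
  vertices of \<open>G\<close>, including those outside \<open>P\<close>, so an unfinished search
  can be described.\<close>

definition MNS_prefix :: "'a pair_pre_digraph \<Rightarrow> 'a list \<Rightarrow> bool" where
  "MNS_prefix G P \<longleftrightarrow> distinct P \<and> set P \<subseteq> pverts G \<and>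
     (\<forall>xs b ys. P = xs @ b # ys \<longrightarrow>
        (\<forall>c \<in> pverts G - set xs. \<not> label G (set xs) b \<subset> label G (set xs) c))"

text \<open>With \<open>xs\<close> the part before \<open>b\<close>, the vertex \<open>a\<close> of
  the MNS condition lies in the label of \<open>c\<close> but not of \<open>b\<close>, and
  \<open>d\<close> lies in the label of \<open>b\<close> but not of \<open>c\<close>. Demanding
  \<open>d\<close> whenever \<open>a\<close> exists excludes precisely strict inclusion of
  labels.\<close>

lemma MNS_ordering_iff_prefix: "MNS_ordering G \<sigma> \<longleftrightarrow> MNS_prefix G \<sigma> \<and> set \<sigma> = pverts G"
proof
  assume mns: "MNS_ordering G \<sigma>"
  then have dist: "distinct \<sigma>" and V: "set \<sigma> = pverts G"
    by (auto simp: MNS_ordering_def vertex_ordering_def)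
  have "\<not> label G (set xs) b \<subset> label G (set xs) c"
    if s: "\<sigma> = xs @ b # ys" and c: "c \<in> pverts G - set xs" for xs b ys c
  proof
    assume less: "label G (set xs) b \<subset> label G (set xs) c"
    then obtain a where a: "a \<in> set xs" "(a, c) \<in> parcs G" "(a, b) \<notin> parcs G"
      by (auto simp: label_def)
    \<comment> \<open>\<open>c\<close> differs from \<open>b\<close> because \<open>a\<close> is
      adjacent to only one of them.\<close>
    then have "c \<in> set ys" using c s V by auto
    then obtain d where "d \<in> set xs" "(d, b) \<in> parcs G" "(d, c) \<notin> parcs G"
      using mns a dist unfolding MNS_ordering_def s by (meson precedes_append_iff)
    with less show False by (auto simp: label_def)
  qed
  with dist V show "MNS_prefix G \<sigma> \<and> set \<sigma> = pverts G" by (auto simp: MNS_prefix_def)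
next
  assume pre: "MNS_prefix G \<sigma> \<and> set \<sigma> = pverts G"
  then have dist: "distinct \<sigma>" and V: "set \<sigma> = pverts G" by (auto simp: MNS_prefix_def)
  have "\<exists>d. precedes \<sigma> d b \<and> (d, b) \<in> parcs G \<and> (d, c) \<notin> parcs G"
    if abc: "precedes \<sigma> a b" "precedes \<sigma> b c" "(a, c) \<in> parcs G" "(a, b) \<notin> parcs G" for a b c
  proof -
    obtain xs ys where s: "\<sigma> = xs @ b # ys"
      using precedes_in_set[OF abc(1)] by (meson split_list)
    have a: "a \<in> set xs" and c: "c \<in> set ys"
      using abc dist unfolding s by (simp_all add: precedes_append_iff)
    then have "c \<in> pverts G - set xs" using dist V s by auto
    then have "\<not> label G (set xs) b \<subset> label G (set xs) c"
      using pre s unfolding MNS_prefix_def by blast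
    with a abc obtain d where "d \<in> set xs" "(d, b) \<in> parcs G" "(d, c) \<notin> parcs G"
      by (auto simp: label_def)
    then show ?thesis using dist unfolding s by (auto simp: precedes_append_iff)
  qed
  with dist V show "MNS_ordering G \<sigma>" by (auto simp: MNS_ordering_def vertex_ordering_def)
qed

lemma MNS_prefix_appendD: "MNS_prefix G (P @ R) \<Longrightarrow> MNS_prefix G P"
  by (auto simp: MNS_prefix_def)

lemma MNS_prefix_snoc_iff:
  "MNS_prefix G (P @ [v]) \<longleftrightarrow> MNS_prefix G P \<and> v \<in> pverts G - set P \<and>
     (\<forall>c \<in> pverts G - set P. \<not> label G (set P) v \<subset> label G (set P) c)"
  (is "?l \<longleftrightarrow> ?r")
proof
  assume ?l
  then show ?r using MNS_prefix_appendD[of G P "[v]"] by (auto simp: MNS_prefix_def)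
next
  assume r: ?r
  have "\<not> label G (set xs) b \<subset> label G (set xs) c"
    if s: "P @ [v] = xs @ b # ys" and c: "c \<in> pverts G - set xs" for xs b ys c
  \<comment> \<open>For empty \<open>ys\<close> the split is at the new vertex \<open>v\<close>;
    otherwise \<open>v\<close> ends \<open>ys\<close> and the split already occurs in
    \<open>P\<close>.\<close>
  proof (cases ys rule: rev_cases)
    case Nil
    with s r c show ?thesis by simp
  next
    case (snoc zs u)
    with s have "P = xs @ b # zs" by (metis append_Cons append_assoc butlast_snoc)
    with r c show ?thesis unfolding MNS_prefix_def by blast
  qed
  with r show ?l by (auto simp: MNS_prefix_def)
qed

section \<open>Greedy extension of prefixes to full MNS orderings\<close>

context pair_graph
begin

text \<open>Maximality is taken in the finite set of labels, since distinct vertices may share a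
  label.\<close>

lemma maximal_label_above:
  assumes "v \<in> pverts G - S"
  obtains u where "u \<in> pverts G - S" "label G S v \<subseteq> label G S u"
    "\<forall>c \<in> pverts G - S. \<not> label G S u \<subset> label G S c"
proof -
  have "finite (label G S ` (pverts G - S))" using pair_finite_verts by simp
  from finite_has_maximal2[OF this, of "label G S v"] assms
  obtain L where L: "L \<in> label G S ` (pverts G - S)" "label G S v \<subseteq> L"
    "\<forall>M \<in> label G S ` (pverts G - S). L \<subseteq> M \<longrightarrow> L = M"
    by blast
  from L(1) obtain u where "u \<in> pverts G - S" "L = label G S u" by blast
  with L(2,3) that[of u] show thesis by blast
qed

text \<open>Keep appending a vertex of maximal label; the number of unvisited vertices
  decreases.\<close>

lemma MNS_prefix_extend:
  assumes "MNS_prefix G P"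
  shows "\<exists>R. MNS_ordering G (P @ R)"
  using assms
proof (induction "card (pverts G - set P)" arbitrary: P rule: less_induct)
  case less
  show ?case
  proof (cases "pverts G - set P = {}")
    case True
    then have "MNS_ordering G (P @ [])"
      using less.prems by (auto simp: MNS_ordering_iff_prefix MNS_prefix_def)
    then show ?thesis by blast
  next
    case False
    then obtain v where "v \<in> pverts G - set P" by blast
    then obtain u where u: "u \<in> pverts G - set P"
      "\<forall>c \<in> pverts G - set P. \<not> label G (set P) u \<subset> label G (set P) c"
      by (rule maximal_label_above)
    then have "MNS_prefix G (P @ [u])" using less.prems by (simp add: MNS_prefix_snoc_iff)
    moreover have "card (pverts G - set (P @ [u])) < card (pverts G - set P)"
      using u pair_finite_verts by (intro psubset_card_mono) auto
    ultimately obtain R where "MNS_ordering G ((P @ [u]) @ R)" using less.hyps by blast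
    then show ?thesis by auto
  qed
qed

subsection \<open>Umbrella-free orderings\<close>

definition umbrella :: "'a list \<Rightarrow> 'a \<Rightarrow> 'a \<Rightarrow> 'a \<Rightarrow> bool" where
  "umbrella \<sigma> a b c \<longleftrightarrow>
     precedes \<sigma> a b \<and> precedes \<sigma> b c \<and> (a, c) \<in> parcs G \<and> (a, b) \<notin> parcs G"

definition MNS_umbrella_free :: bool where
  "MNS_umbrella_free \<longleftrightarrow> (\<forall>\<sigma> a b c. MNS_ordering G \<sigma> \<longrightarrow> \<not> umbrella \<sigma> a b c)"

lemma P4_C4_free_imp_MNS_umbrella_free:
  assumes "P4_C4_free G"
  shows MNS_umbrella_free
proof -
  \<comment> \<open>Umbrellas are indexed by positions so that the middle position \<open>j\<close>
    can serve as induction measure.\<close>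
  have no_umbrella: False if mns: "MNS_ordering G \<sigma>"
    and "i < j" "j < k" "k < length \<sigma>" "(\<sigma> ! i, \<sigma> ! k) \<in> parcs G" "(\<sigma> ! i, \<sigma> ! j) \<notin> parcs G"
    for \<sigma> i j k
    using that(2-)
  proof (induction j arbitrary: i k rule: less_induct)
    case (less j)
    have dist: "distinct \<sigma>" using mns by (simp add: MNS_ordering_def vertex_ordering_def)
    have prec: "precedes \<sigma> (\<sigma> ! i) (\<sigma> ! j)" "precedes \<sigma> (\<sigma> ! j) (\<sigma> ! k)"
      using less.prems by (auto simp: precedes_nth_iff[OF dist])
    then obtain d where d: "precedes \<sigma> d (\<sigma> ! j)" "(d, \<sigma> ! j) \<in> parcs G" "(d, \<sigma> ! k) \<notin> parcs G"
      using mns less.prems unfolding MNS_ordering_def by blast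
    then obtain l where l: "l < length \<sigma>" "d = \<sigma> ! l"
      by (metis in_set_conv_nth precedes_in_set)
    with d(1) less.prems have lj: "l < j" by (simp add: precedes_nth_iff[OF dist])
    have li: "l \<noteq> i" using d l less.prems by auto
    have neq: "\<sigma> ! l \<noteq> \<sigma> ! k" "\<sigma> ! j \<noteq> \<sigma> ! i" "\<sigma> ! j \<noteq> \<sigma> ! k" "\<sigma> ! l \<noteq> \<sigma> ! i"
      using less.prems l lj li by (simp_all add: nth_eq_iff_index_eq[OF dist])
    have free: "\<not> P4_or_C4 G x y z w" for x y z w
      using assms P4_C4_free_iff by blast
    \<comment> \<open>Either cross edge would join the disjoint edges \<open>ik\<close> and
      \<open>lj\<close> into a path of three edges whose two short chords, \<open>ij\<close> and
      \<open>lk\<close>, are missing.\<close>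
    have jk: "(\<sigma> ! j, \<sigma> ! k) \<notin> parcs G"
      using free[of "\<sigma> ! l" "\<sigma> ! j" "\<sigma> ! k" "\<sigma> ! i"] less.prems d l neq edge_commute
      unfolding P4_or_C4_def by blast
    have il: "(\<sigma> ! i, \<sigma> ! l) \<notin> parcs G"
      using free[of "\<sigma> ! j" "\<sigma> ! l" "\<sigma> ! i" "\<sigma> ! k"] less.prems d l neq edge_commute
      unfolding P4_or_C4_def by blast
    show False
    \<comment> \<open>The smaller umbrella is \<open>l < i < j\<close> with edge \<open>lj\<close>
      if \<open>l < i\<close>, and \<open>i < l < k\<close> with edge \<open>ik\<close>
      otherwise.\<close>
    proof (cases "l < i")
      case True
      then show False using less.IH[of i l j] less.prems d l il edge_commute[of "\<sigma> ! i" "\<sigma> ! l"] by auto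
    next
      case False
      then show False using less.IH[of l i k] less.prems lj li il by auto
    qed
  qed
  show ?thesis
    unfolding MNS_umbrella_free_def umbrella_def
  proof (intro allI impI notI, elim conjE)
    fix \<sigma> a b c
    assume mns: "MNS_ordering G \<sigma>" and abc: "precedes \<sigma> a b" "precedes \<sigma> b c"
      "(a, c) \<in> parcs G" "(a, b) \<notin> parcs G"
    have dist: "distinct \<sigma>" using mns by (simp add: MNS_ordering_def vertex_ordering_def)
    obtain i j k where "i < length \<sigma>" "a = \<sigma> ! i" "j < length \<sigma>" "b = \<sigma> ! j"
      "k < length \<sigma>" "c = \<sigma> ! k"
      using abc precedes_in_set by (metis in_set_conv_nth)
    with abc mns show False
      using no_umbrella[of \<sigma> i j k] by (simp add: precedes_nth_iff[OF dist])
  qed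
qed

text \<open>The pattern is symmetric under reversal, so after the start \<open>y, z\<close> either
  relative order of \<open>x\<close> and \<open>w\<close> produces an umbrella, however the search
  continues.\<close>

lemma MNS_umbrella_free_imp_P4_C4_free:
  assumes MNS_umbrella_free
  shows "P4_C4_free G"
  unfolding P4_C4_free_iff
proof (intro allI notI)
  fix x y z w assume "P4_or_C4 G x y z w"
  then have neq: "x \<noteq> z" "y \<noteq> w" and E: "(x, y) \<in> parcs G" "(y, z) \<in> parcs G" "(z, w) \<in> parcs G"
    "(x, z) \<notin> parcs G" "(y, w) \<notin> parcs G"
    by (auto simp: P4_or_C4_def)
  have V: "x \<in> pverts G" "y \<in> pverts G" "z \<in> pverts G" "w \<in> pverts G"
    using E in_arcsD1 in_arcsD2 by blast+
  have "MNS_prefix G []" by (simp add: MNS_prefix_def)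
  \<comment> \<open>Initially all labels are empty, so any vertex can come first. After
    \<open>y\<close>, every label is contained in \<open>{y}\<close>, which is the label of its
    neighbour \<open>z\<close>.\<close>
  then have "MNS_prefix G [y]"
    using V MNS_prefix_snoc_iff[of G "[]" y] by (simp add: label_def)
  then have "MNS_prefix G [y, z]"
    using V E no_loop MNS_prefix_snoc_iff[of G "[y]" z] by (auto simp: label_def)
  then obtain R where mns: "MNS_ordering G (y # z # R)"
    using MNS_prefix_extend by fastforce
  then have dist: "distinct (y # z # R)" and set: "set (y # z # R) = pverts G"
    by (auto simp: MNS_ordering_def vertex_ordering_def)
  have "x \<noteq> y" "w \<noteq> z" "x \<noteq> w" using E no_loop edge_commute by blast+
  then have "x \<in> set R" and wR: "w \<in> set R" using set V neq by auto
  then obtain A B where R: "R = A @ x # B" by (meson split_list)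
  show False
  proof (cases "w \<in> set B")
    case True
    have "umbrella (y # z # R) z x w"
      using True E edge_commute[of x z] precedes_append_iff[of "y # z # A" x B] dist
      by (auto simp: umbrella_def R)
    then show False using assms mns by (auto simp: MNS_umbrella_free_def)
  next
    case False
    then obtain C D where A: "A = C @ w # D" using wR \<open>x \<noteq> w\<close> R by (auto dest: split_list)
    have "umbrella (y # z # R) y w x"
      using E edge_commute[of x y] precedes_append_iff[of "y # z # C" w "D @ x # B"] dist
      by (auto simp: umbrella_def R A)
    then show False using assms mns by (auto simp: MNS_umbrella_free_def)
  qed
qed

text \<open>Let \<open>P\<close> be the part of the ordering before \<open>b\<close>. The label of
  \<open>b\<close> is maximal there, and so is that of some \<open>v\<close> whose label contains
  the label of \<open>c\<close>. The given ordering chooses \<open>b\<close> next; choosing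
  \<open>v\<close> instead extends to a second ordering.\<close>

lemma umbrella_imp_incomparable_choices:
  assumes mns: "MNS_ordering G \<sigma>" and umb: "umbrella \<sigma> a b c"
  obtains P u v R R' where "MNS_ordering G (P @ u # R)" "MNS_ordering G (P @ v # R')"
    "v \<in> set R" "u \<in> set R'" "label G (set P) u \<noteq> label G (set P) v"
proof -
  have dist: "distinct \<sigma>" and V: "set \<sigma> = pverts G"
    using mns by (auto simp: MNS_ordering_def vertex_ordering_def)
  obtain P ys where s: "\<sigma> = P @ b # ys"
    using umb precedes_in_set by (metis split_list umbrella_def)
  have a: "a \<in> set P" and c: "c \<in> set ys"
    using umb dist unfolding s umbrella_def by (simp_all add: precedes_append_iff)
  have "c \<in> pverts G - set P" using c dist V s by auto
  then obtain v where v: "v \<in> pverts G - set P" "label G (set P) c \<subseteq> label G (set P) v"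
    "\<forall>c \<in> pverts G - set P. \<not> label G (set P) v \<subset> label G (set P) c"
    by (rule maximal_label_above)
  have b: "b \<in> pverts G - set P" using V s dist by auto
  have P: "MNS_prefix G P"
    using mns MNS_prefix_appendD unfolding MNS_ordering_iff_prefix s by blast
  then have "MNS_prefix G (P @ [v])" using v by (simp add: MNS_prefix_snoc_iff)
  then obtain R' where R': "MNS_ordering G (P @ v # R')" using MNS_prefix_extend by fastforce
  \<comment> \<open>The vertex \<open>a\<close> belongs to the label of \<open>c\<close>, hence to
    that of \<open>v\<close>, but not to that of \<open>b\<close>.\<close>
  have ne: "label G (set P) b \<noteq> label G (set P) v"
    using a umb v(2) by (auto simp: umbrella_def label_def)
  then have "b \<noteq> v" by auto
  then have "b \<in> set R'" "v \<in> set ys"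
    using R' V s b v by (auto simp: MNS_ordering_def vertex_ordering_def)
  with mns R' ne that show thesis unfolding s by blast
qed

text \<open>The vertex \<open>e\<close> is adjacent to exactly one of \<open>u\<close>,
  \<open>v\<close>. In the ordering that chooses the other one right after \<open>P\<close>, these
  three form an umbrella, and the LexDFS witness would be a vertex after \<open>e\<close> in
  \<open>P\<close> that distinguishes \<open>u\<close> from \<open>v\<close>.\<close>

lemma LexDFS_imp_MNS_umbrella_free:
  assumes lex: "\<forall>\<sigma>. MNS_ordering G \<sigma> \<longrightarrow> LexDFS_ordering G \<sigma>"
  shows MNS_umbrella_free
  unfolding MNS_umbrella_free_def
proof (intro allI impI notI)
  fix \<sigma> a b c assume "MNS_ordering G \<sigma>" "umbrella \<sigma> a b c"
  then obtain P u v R R' where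
    uv: "MNS_ordering G (P @ u # R)" "MNS_ordering G (P @ v # R')" "v \<in> set R" "u \<in> set R'"
    and ne: "label G (set P) u \<noteq> label G (set P) v"
    by (rule umbrella_imp_incomparable_choices)
  from ne have "\<exists>e \<in> set P. ((e, u) \<in> parcs G) \<noteq> ((e, v) \<in> parcs G)" by (auto simp: label_def)
  from split_list_last_prop[OF this] obtain A e B where P: "P = A @ e # B"
    and e: "((e, u) \<in> parcs G) \<noteq> ((e, v) \<in> parcs G)"
    and last: "\<forall>d \<in> set B. (d, u) \<in> parcs G \<longleftrightarrow> (d, v) \<in> parcs G"
    by blast
  \<comment> \<open>Stated for generic \<open>u'\<close>, \<open>v'\<close> because the roles of
    \<open>u\<close> and \<open>v\<close> are exchanged in the second use.\<close>
  have *: "(e, u') \<in> parcs G" if mns: "MNS_ordering G (P @ u' # S)" and v': "v' \<in> set S"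
    "(e, v') \<in> parcs G" and same: "\<forall>d \<in> set B. (d, u') \<in> parcs G \<longleftrightarrow> (d, v') \<in> parcs G" for u' v' S
  proof (rule ccontr)
    assume eu: "(e, u') \<notin> parcs G"
    let ?s = "P @ u' # S"
    have dist: "distinct ?s" using mns by (simp add: MNS_ordering_def vertex_ordering_def)
    have "precedes ?s e u'" "precedes ?s u' v'"
      using v' precedes_append_iff[OF dist] by (auto simp: P)
    then obtain d where d: "precedes ?s e d" "precedes ?s d u'" "(d, u') \<in> parcs G" "(d, v') \<notin> parcs G"
      using lex mns v'(2) eu unfolding LexDFS_ordering_def by blast
    have "d \<in> set P" using d(2) precedes_append_iff[OF dist] by simp
    moreover have "d \<in> set (B @ u' # S)"
      using d(1) dist precedes_append_iff(2)[of A e "B @ u' # S" d] by (simp add: P)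
    \<comment> \<open>Being after \<open>e\<close> and before \<open>u'\<close>, the witness
      \<open>d\<close> is confined to \<open>B\<close>, where \<open>u'\<close> and
      \<open>v'\<close> have the same neighbours.\<close>
    ultimately have "d \<in> set B" using dist by (auto simp: P)
    with d same show False by blast
  qed
  show False using *[of u R v] *[of v R' u] uv e last by blast
qed

text \<open>Here the witness has to precede \<open>e\<close>, so choosing \<open>e\<close> as the
  first distinguishing vertex confines it to \<open>A\<close>, where nothing separates
  \<open>u\<close> from \<open>v\<close>.\<close>

lemma LexBFS_imp_MNS_umbrella_free:
  assumes lex: "\<forall>\<sigma>. MNS_ordering G \<sigma> \<longrightarrow> LexBFS_ordering G \<sigma>"
  shows MNS_umbrella_free
  unfolding MNS_umbrella_free_def
proof (intro allI impI notI)
  fix \<sigma> a b c assume "MNS_ordering G \<sigma>" "umbrella \<sigma> a b c"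
  then obtain P u v R R' where
    uv: "MNS_ordering G (P @ u # R)" "MNS_ordering G (P @ v # R')" "v \<in> set R" "u \<in> set R'"
    and ne: "label G (set P) u \<noteq> label G (set P) v"
    by (rule umbrella_imp_incomparable_choices)
  from ne have "\<exists>e \<in> set P. ((e, u) \<in> parcs G) \<noteq> ((e, v) \<in> parcs G)" by (auto simp: label_def)
  from split_list_first_prop[OF this] obtain A e B where P: "P = A @ e # B"
    and e: "((e, u) \<in> parcs G) \<noteq> ((e, v) \<in> parcs G)"
    and first: "\<forall>d \<in> set A. (d, u) \<in> parcs G \<longleftrightarrow> (d, v) \<in> parcs G"
    by blast
  have *: "(e, u') \<in> parcs G" if mns: "MNS_ordering G (P @ u' # S)" and v': "v' \<in> set S"
    "(e, v') \<in> parcs G" and same: "\<forall>d \<in> set A. (d, u') \<in> parcs G \<longleftrightarrow> (d, v') \<in> parcs G" for u' v' S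
  proof (rule ccontr)
    assume eu: "(e, u') \<notin> parcs G"
    let ?s = "P @ u' # S"
    have dist: "distinct ?s" using mns by (simp add: MNS_ordering_def vertex_ordering_def)
    have "precedes ?s e u'" "precedes ?s u' v'"
      using v' precedes_append_iff[OF dist] by (auto simp: P)
    then obtain d where d: "precedes ?s d e" "(d, u') \<in> parcs G" "(d, v') \<notin> parcs G"
      using lex mns v'(2) eu unfolding LexBFS_ordering_def by blast
    have "d \<in> set A"
      using d(1) dist precedes_append_iff(1)[of A e "B @ u' # S" d] by (simp add: P)
    with d same show False by blast
  qed
  show False using *[of u R v] *[of v R' u] uv e first by blast
qed

text \<open>The conditions on triples become vacuous.\<close>

lemma MNS_umbrella_free_imp_Lex:
  assumes MNS_umbrella_free "MNS_ordering G \<sigma>"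
  shows "LexDFS_ordering G \<sigma>" "LexBFS_ordering G \<sigma>"
  using assms
  unfolding MNS_umbrella_free_def umbrella_def LexDFS_ordering_def LexBFS_ordering_def
    MNS_ordering_def by blast+

end

theorem theorem3:
  fixes G :: "'a pair_pre_digraph"
  assumes "pair_graph G" and "Digraph_Component.connected (with_proj G)"
  shows "(P4_C4_free G \<longleftrightarrow> (\<forall>\<sigma>. MNS_ordering G \<sigma> \<longrightarrow> LexDFS_ordering G \<sigma>)) \<and>
         ((\<forall>\<sigma>. MNS_ordering G \<sigma> \<longrightarrow> LexDFS_ordering G \<sigma>) \<longleftrightarrow>
          (\<forall>\<sigma>. MNS_ordering G \<sigma> \<longrightarrow> LexBFS_ordering G \<sigma>))"
proof -
  interpret pair_graph G by fact
  show ?thesis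
    using P4_C4_free_imp_MNS_umbrella_free MNS_umbrella_free_imp_P4_C4_free
      LexDFS_imp_MNS_umbrella_free LexBFS_imp_MNS_umbrella_free MNS_umbrella_free_imp_Lex
    by blast
qed

end
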